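(* Let $(\mu_t)_{t\in I}$ be an $n$-dimensional spacelike Brakke flow in $\mathbf R^{n,m}$ with boundary $\Gamma$. Suppose that, for $[a,b]\subset I$, $$\int_a^b\int v^2(\mu_t,\cdot)\,d\mu_tdt<\infty.$$ Then $$\int d\mu_b\ge\int d\mu_a.$$
   Context: **Ambient space.** $\mathbf R^{n,m}$ is $\mathbf R^{n+m}$ with $\langle u,w\rangle=\sum_{i=1}^n u^iw^i-\sum_{i=n+1}^{n+m}u^iw^i$ and canonical basis $e_1,\dots,e_{n+m}$; $\langle\cdot,\cdot\rangle_E$ and $|\cdot|_E$ are the Euclidean product and norm. A vector $u$ is spacelike if $\langle u,u\rangle>0$ or $u=0$; a subspace is spacelike if $\langle\cdot,\cdot\rangle$ is positive definite on it; a submanifold is spacelike if its tangent spaces are. Orthogonality, $\perp$, orthogonal projections and gradients $\nabla$ are with respect to $\langle\cdot,\cdot\rangle$. $K\Subset U$ means $K$ has compact closure in $U$; $\mathbf R^+=[0,\infty)$. **Rectifiable sets and area.** An $\mathcal H^n$-measurable set $M$ is $n$-rectifiable if $\mathcal H^n$-almost all of it is covered by countably many $n$-dimensional $C^1$ submanifolds; $\operatorname{Tan}(M,x)$ is its (approximate) tangent plane, which exists $\mathcal H^n$-a.e. $M$ is spacelike if $\operatorname{Tan}(M,x)$ is spacelike wherever it exists. For a spacelike plane $P$, $S(P)=\sqrt{\det(\langle\cdot,\cdot\rangle|_P)}/\sqrt{\det(\langle\cdot,\cdot\rangle_E|_P)}$, and $d\sigma^n=S(\operatorname{Tan}(M,\cdot))\,d\mathcal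 H^n$ on $M$; $\sigma^{n-1}$ is defined likewise. **Gradient function.** For a spacelike $n$-plane $P$, $v^2(P)=\sum_{i=n+1}^{n+m}-\langle e_i^\perp,e_i^\perp\rangle\ge m$, $e_i^\perp$ the projection of $e_i$ onto $P^\perp$. **Spacelike integer measures.** A Radon measure $\mu$ on an open set $U$ is spacelike integer $n$-rectifiable if $\mu=\theta\,\sigma^n\llcorner M$ with $M\subset U$ spacelike $n$-rectifiable and $\theta\in L^1_{\rm loc}(M,\sigma^n)$ nonnegative-integer valued; $\operatorname{Tan}(\mu,x)=\operatorname{Tan}(M,x)$. **First variation.** For $X\in C^1_c(U;\mathbf R^{n,m})$, $\operatorname{Div}_\mu X=\sum_{i=1}^n\langle\tau_i,\nabla_{\tau_i}X\rangle$ with $\{\tau_i\}$ an orthonormal basis of $\operatorname{Tan}(\mu,x)$, and $\delta V(X)=\int\operatorname{Div}_\mu X\,d\mu$. It is locally bounded if for each $K\Subset U$ there is $c_K$ with $|\delta V(X)|\le c_K\sup_K|X|_E$ whenever $\operatorname{spt}X\subset K$. Then $\delta V(X)=\int\langle X,\tilde\eta\rangle_E\,d|\delta V|$ with $|\tilde\eta|_E=1$ (Riesz) and $|\delta V|=f\mu+\beta$ with $\beta$ singular to $\mu$ (Radon–Nikodym). With $\xi=\operatorname{diag}(1,\dots,1,-1,\dots,-1)$ put $H=-\xi f\tilde\eta$, $\eta=\xi\tilde\eta$, so $\int\operatorname{Div}_\mu X\,d\mu=-\int\langle H,X\rangle\,d\mu+\int\langle X,\eta\rangle\,d\beta$. **The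 class $S\mathscr V_n(U,\Gamma)$** ($\Gamma$ a properly embedded $(n-1)$-dimensional spacelike submanifold of $U$): spacelike integer $n$-rectifiable Radon measures $\mu$ on $U$ with locally bounded first variation such that (1) $H(x)\in\operatorname{Tan}(\mu,x)^\perp$ for $\mu$-a.e. $x$; (2) $\eta(x)\in\operatorname{Tan}(\Gamma,x)^\perp$ is spacelike for $\beta$-a.e. $x$; (3) $\sqrt{\langle\eta,\eta\rangle}\,\beta\le\sigma^{n-1}\llcorner\Gamma$ (in particular $\operatorname{spt}\beta\subset\Gamma$). **Spacelike Brakke flow.** An $n$-dimensional spacelike Brakke flow with boundary $\Gamma$ in $U$ over an interval $I$ is a family $(\mu_t)_{t\in I}$ of Radon measures on $U$, where $\Gamma$ is a smooth, properly embedded $(n-1)$-dimensional spacelike submanifold of $U$, such that: (1) $\mu_t\in S\mathscr V_n(U,\Gamma)$ for a.e. $t\in I$; (2) $\int_a^b\int_K(1-\langle H,H\rangle)\,d\mu_tdt<\infty$ for $[a,b]\subset I$ and compact $K\subset U$; (3) for $[a,b]\subset I$ and $\phi\in C^2_c(U\times[a,b];\mathbf R^+)$, $\mu_b(\phi)-\mu_a(\phi)\ge\int_a^b\int\big(-\phi\langle H,H\rangle+\langle\nabla\phi,H\rangle+\partial_t\phi\big)\,d\mu_tdt$. Here $H=H(\mu_t,\cdot)$ and $\mu(\phi)=\int\phi\,d\mu$. $v^2(\mu_t,x)=v^2(\operatorname{Tan}(\mu_t,x))$ if $\mu_t\in S\mathscr V_n(U,\Gamma)$ and the tangent plane exists,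 and $v^2(\mu_t,x)=m$ otherwise. *)

theory Defs
  imports "HOL-Analysis.Analysis"
begin

section \<open>The space \<open>\<real>\<^sup>n\<^sup>,\<^sup>m\<close>\<close>

text \<open>
  The coordinates \<open>1, \<dots>, n\<close> are indexed by \<^term>\<open>Inl\<close>, the coordinates
  \<open>n + 1, \<dots>, n + m\<close> by \<^term>\<open>Inr\<close>; \<open>n = CARD('n)\<close> and \<open>m = CARD('m)\<close>.
  The inner product and norm of the type are the Euclidean ones.
\<close>

type_synonym ('n, 'm) minkowski = "(real, 'n + 'm) vec"

definition lor :: "('n::finite, 'm::finite) minkowski \<Rightarrow> ('n, 'm) minkowski \<Rightarrow> real" where
  "lor u w = (\<Sum>i\<in>UNIV. u $ Inl i * w $ Inl i) - (\<Sum>j\<in>UNIV. u $ Inr j * w $ Inr j)"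

definition xi :: "('n::finite, 'm::finite) minkowski \<Rightarrow> ('n, 'm) minkowski" where
  "xi u = (\<chi> k. case k of Inl i \<Rightarrow> u $ k | Inr j \<Rightarrow> - (u $ k))"

definition spacelike_vector :: "('n::finite, 'm::finite) minkowski \<Rightarrow> bool" where
  "spacelike_vector u \<longleftrightarrow> lor u u > 0 \<or> u = 0"

definition spacelike_subspace :: "('n::finite, 'm::finite) minkowski set \<Rightarrow> bool" where
  "spacelike_subspace P \<longleftrightarrow> subspace P \<and> (\<forall>u\<in>P. u \<noteq> 0 \<longrightarrow> lor u u > 0)"

definition lor_perp :: "('n::finite, 'm::finite) minkowski set \<Rightarrow> ('n, 'm) minkowski set" where
  "lor_perp P = {u. \<forall>p\<in>P. lor u p = 0}"

text \<open>Component of \<open>u\<close> in \<open>P\<^sup>\<bottom>\<close>; well defined whenever \<open>P\<close> is a spacelike subspace.\<close>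

definition perp_part :: "('n::finite, 'm::finite) minkowski set \<Rightarrow> ('n, 'm) minkowski \<Rightarrow> ('n, 'm) minkowski" where
  "perp_part P u = (THE q. q \<in> lor_perp P \<and> u - q \<in> P)"

definition lor_grad :: "(('n::finite, 'm::finite) minkowski \<Rightarrow> real) \<Rightarrow> ('n, 'm) minkowski \<Rightarrow> ('n, 'm) minkowski" where
  "lor_grad f x = (THE g. \<forall>v. lor g v = frechet_derivative f (at x) v)"

definition lor_orthonormal_basis :: "('n::finite, 'm::finite) minkowski set \<Rightarrow> ('n, 'm) minkowski set \<Rightarrow> bool" where
  "lor_orthonormal_basis P B \<longleftrightarrow>
     B \<subseteq> P \<and> span B = P \<and> (\<forall>u\<in>B. \<forall>w\<in>B. lor u w = (if u = w then 1 else 0))"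

definition grad_fun_sq :: "('n::finite, 'm::finite) minkowski set \<Rightarrow> real" where
  "grad_fun_sq P =
     (\<Sum>j\<in>UNIV. - lor (perp_part P (axis (Inr j) 1)) (perp_part P (axis (Inr j) 1)))"

text \<open>
  Determinant of a \<open>k \<times> k\<close> matrix, with \<open>k\<close> a number rather than a type. The quotient
  \<open>area_factor\<close> of Gram determinants does not depend on the basis of \<open>P\<close>.
\<close>

definition det_nat :: "nat \<Rightarrow> (nat \<Rightarrow> nat \<Rightarrow> real) \<Rightarrow> real" where
  "det_nat k A = (\<Sum>p | p permutes {..<k}. of_int (sign p) * (\<Prod>i<k. A i (p i)))"

definition area_factor :: "('n::finite, 'm::finite) minkowski set \<Rightarrow> real" where
  "area_factor P =
     (let k = dim P;
          b = (SOME b. inj_on b {..<k} \<and> independent (b ` {..<k}) \<and> span (b ` {..<k}) = P)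
      in sqrt (det_nat k (\<lambda>i j. lor (b i) (b j))) / sqrt (det_nat k (\<lambda>i j. b i \<bullet> b j)))"


section \<open>Differentiability classes, test functions and submanifolds\<close>

text \<open>Intended for open \<open>U\<close>.\<close>

primrec C_nat_on :: "nat \<Rightarrow> 'a::euclidean_space set \<Rightarrow> ('a \<Rightarrow> 'b::real_normed_vector) \<Rightarrow> bool" where
  "C_nat_on 0 U f \<longleftrightarrow> continuous_on U f"
| "C_nat_on (Suc k) U f \<longleftrightarrow>
     f differentiable_on U \<and> (\<forall>v. C_nat_on k U (\<lambda>x. frechet_derivative f (at x) v))"

definition C_on :: "enat \<Rightarrow> 'a::euclidean_space set \<Rightarrow> ('a \<Rightarrow> 'b::real_normed_vector) \<Rightarrow> bool" where
  "C_on r U f \<longleftrightarrow> (\<forall>k. enat k \<le> r \<longrightarrow> C_nat_on k U f)"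

definition spt :: "('a::topological_space \<Rightarrow> 'b::zero) \<Rightarrow> 'a set" where
  "spt f = closure {x. f x \<noteq> 0}"

text \<open>
  Functions with compact support in an open set \<open>U\<close> are identified with their extension by
  zero to the whole space.
\<close>

definition C1_c :: "'a::euclidean_space set \<Rightarrow> ('a \<Rightarrow> 'a) set" where
  "C1_c U = {X. C_on 1 UNIV X \<and> compact (spt X) \<and> spt X \<subseteq> U}"

text \<open>
  Nonnegative \<open>C\<^sup>2\<close> functions on \<open>U \<times> [a, b]\<close> with compact support, \<open>C\<^sup>2\<close> up to the times
  \<open>a\<close> and \<open>b\<close>: they are the restrictions of \<open>C\<^sup>2\<close> functions of all \<open>(x, t)\<close>.
\<close>

definition C2_c_nonneg :: "'a::euclidean_space set \<Rightarrow> real \<Rightarrow> real \<Rightarrow> ('a \<times> real \<Rightarrow> real) set" where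
  "C2_c_nonneg U a b =
     {\<phi>. C_on 2 UNIV \<phi> \<and> (\<forall>x\<in>U. \<forall>t\<in>{a..b}. 0 \<le> \<phi> (x, t)) \<and>
         (\<exists>K. compact K \<and> K \<subseteq> U \<and> (\<forall>x. \<forall>t\<in>{a..b}. x \<notin> K \<longrightarrow> \<phi> (x, t) = 0))}"

text \<open>Embedded \<open>d\<close>-dimensional submanifolds of class \<open>C\<^sup>r\<close>, by slice charts.\<close>

definition submanifold :: "enat \<Rightarrow> nat \<Rightarrow> 'a::euclidean_space set \<Rightarrow> bool" where
  "submanifold r d N \<longleftrightarrow>
     (\<forall>p\<in>N. \<exists>W (\<Phi> :: 'a \<Rightarrow> 'a) \<Psi> P.
        open W \<and> p \<in> W \<and> open (\<Phi> ` W) \<and> C_on r W \<Phi> \<and> C_on r (\<Phi> ` W) \<Psi> \<and>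
        (\<forall>x\<in>W. \<Psi> (\<Phi> x) = x) \<and> subspace P \<and> dim P = d \<and> \<Phi> ` (N \<inter> W) = P \<inter> \<Phi> ` W)"

definition tangent_space :: "'a::euclidean_space set \<Rightarrow> 'a \<Rightarrow> 'a set" where
  "tangent_space N x =
     {v. \<exists>\<gamma> :: real \<Rightarrow> 'a. \<gamma> 0 = x \<and> (\<forall>t. \<gamma> t \<in> N) \<and> (\<gamma> has_vector_derivative v) (at 0)}"

definition spacelike_submanifold :: "enat \<Rightarrow> nat \<Rightarrow> ('n::finite, 'm::finite) minkowski set \<Rightarrow> bool" where
  "spacelike_submanifold r d N \<longleftrightarrow>
     submanifold r d N \<and> (\<forall>x\<in>N. spacelike_subspace (tangent_space N x))"

definition properly_embedded :: "'a::euclidean_space set \<Rightarrow> 'a set \<Rightarrow> bool" where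
  "properly_embedded U N \<longleftrightarrow> closedin (top_of_set U) N"


section \<open>Hausdorff measure\<close>

definition hausdorff_pre :: "nat \<Rightarrow> real \<Rightarrow> 'a::metric_space set \<Rightarrow> ennreal" where
  "hausdorff_pre k \<delta> A =
     (INF C \<in> {C :: nat \<Rightarrow> 'a set. A \<subseteq> (\<Union>i. C i) \<and> (\<forall>i. bounded (C i) \<and> diameter (C i) \<le> \<delta>)}.
        \<Sum>i. if C i = {} then 0 else ennreal (unit_ball_vol (real k) * (diameter (C i) / 2) ^ k))"

definition hausdorff_outer :: "nat \<Rightarrow> 'a::metric_space set \<Rightarrow> ennreal" where
  "hausdorff_outer k A = (SUP \<delta>\<in>{0<..}. hausdorff_pre k \<delta> A)"

text \<open>The measurable sets are those of Caratheodory's criterion.\<close>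

definition hausdorff :: "nat \<Rightarrow> 'a::metric_space measure" where
  "hausdorff k = measure_of UNIV (lambda_system UNIV UNIV (hausdorff_outer k)) (hausdorff_outer k)"

lemma hausdorff_pre_empty: "0 < \<delta> \<Longrightarrow> hausdorff_pre k \<delta> {} = 0"
  unfolding hausdorff_pre_def
  by (rule antisym, rule INF_lower2[of "\<lambda>_. {}"]) auto

lemma hausdorff_pre_mono: "A \<subseteq> B \<Longrightarrow> hausdorff_pre k \<delta> A \<le> hausdorff_pre k \<delta> B"
  unfolding hausdorff_pre_def by (rule INF_superset_mono) auto

lemma hausdorff_pre_UN: "hausdorff_pre k \<delta> (\<Union>i. A i) \<le> (\<Sum>i. hausdorff_pre k \<delta> (A i))"
proof (rule ennreal_le_epsilon)
  fix e :: real
  assume fin: "(\<Sum>i. hausdorff_pre k \<delta> (A i)) < top" and e: "0 < e"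
  define w :: "'a set \<Rightarrow> ennreal" where
    "w S = (if S = {} then 0 else ennreal (unit_ball_vol (real k) * (diameter S / 2) ^ k))" for S
  define Q :: "'a set \<Rightarrow> (nat \<Rightarrow> 'a set) set" where
    "Q B = {C. B \<subseteq> (\<Union>i. C i) \<and> (\<forall>i. bounded (C i) \<and> diameter (C i) \<le> \<delta>)}" for B
  have pre: "hausdorff_pre k \<delta> B = (INF C\<in>Q B. \<Sum>i. w (C i))" for B
    by (simp add: hausdorff_pre_def Q_def w_def)
  have "\<exists>C. C \<in> Q (A i) \<and> (\<Sum>j. w (C j)) \<le> hausdorff_pre k \<delta> (A i) + ennreal (e * (1 / 2) ^ Suc i)" for i
  proof -
    have "hausdorff_pre k \<delta> (A i) < top"
      using fin ennreal_suminf_lessD by blast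
    moreover have "0 < ennreal (e * (1 / 2) ^ Suc i)"
      using e by simp
    ultimately have "(INF C\<in>Q (A i). \<Sum>j. w (C j))
        < hausdorff_pre k \<delta> (A i) + ennreal (e * (1 / 2) ^ Suc i)"
      unfolding pre[symmetric] by (simp add: ennreal_add_left_cancel_less[of _ 0, simplified])
    then show ?thesis
      unfolding INF_less_iff by (meson less_imp_le)
  qed
  then obtain C where C: "\<And>i. C i \<in> Q (A i)"
    and le: "\<And>i. (\<Sum>j. w (C i j)) \<le> hausdorff_pre k \<delta> (A i) + ennreal (e * (1 / 2) ^ Suc i)"
    by metis
  let ?D = "\<lambda>k. case prod_decode k of (i, j) \<Rightarrow> C i j"
  have "?D \<in> Q (\<Union>i. A i)"
  proof -
    have "(\<Union>i. A i) \<subseteq> (\<Union>k. ?D k)"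
    proof
      fix x assume "x \<in> (\<Union>i. A i)"
      then obtain i where "x \<in> A i" by blast
      moreover have "A i \<subseteq> (\<Union>j. C i j)" using C[of i] by (simp add: Q_def)
      ultimately obtain j where "x \<in> C i j" by blast
      then have "x \<in> ?D (prod_encode (i, j))" by simp
      then show "x \<in> (\<Union>k. ?D k)" by (intro UN_I[of "prod_encode (i, j)"]) simp_all
    qed
    then show ?thesis using C by (simp add: Q_def split: prod.split)
  qed
  then have "hausdorff_pre k \<delta> (\<Union>i. A i) \<le> (\<Sum>k. w (?D k))"
    unfolding pre by (rule INF_lower)
  also have "\<dots> = (\<Sum>i. \<Sum>j. w (C i j))"
    by (subst suminf_ennreal_2dimen[of "\<lambda>i. \<Sum>j. w (C i j)" "\<lambda>(i, j). w (C i j)", symmetric])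
      (auto simp: o_def split_beta)
  also have "\<dots> \<le> (\<Sum>i. hausdorff_pre k \<delta> (A i) + ennreal (e * (1 / 2) ^ Suc i))"
    by (intro suminf_le le) auto
  also have "\<dots> = (\<Sum>i. hausdorff_pre k \<delta> (A i)) + (\<Sum>i. ennreal (e * (1 / 2) ^ Suc i))"
    by (rule suminf_add[symmetric]) auto
  also have "(\<Sum>i. ennreal (e * (1 / 2) ^ Suc i)) = ennreal e"
    using e sums_mult[OF power_half_series, of e] by (intro suminf_ennreal_eq) auto
  finally show "hausdorff_pre k \<delta> (\<Union>i. A i) \<le> (\<Sum>i. hausdorff_pre k \<delta> (A i)) + ennreal e" .
qed

lemma outer_measure_space_hausdorff: "outer_measure_space UNIV (hausdorff_outer k)"
proof -
  have "hausdorff_outer k (\<Union>i. A i) \<le> (\<Sum>i. hausdorff_outer k (A i))" for A :: "nat \<Rightarrow> 'a set"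
    unfolding hausdorff_outer_def
    by (intro SUP_least order_trans[OF hausdorff_pre_UN] suminf_le SUP_upper) auto
  moreover have "hausdorff_outer k A \<le> hausdorff_outer k B" if "A \<subseteq> B" for A B :: "'a set"
    unfolding hausdorff_outer_def using that by (intro SUP_mono) (auto intro: hausdorff_pre_mono)
  moreover have "hausdorff_outer k ({} :: 'a set) = 0"
    by (simp add: hausdorff_outer_def hausdorff_pre_empty)
  ultimately show ?thesis
    by (auto simp: outer_measure_space_def positive_def increasing_def countably_subadditive_def)
qed

lemma measure_space_hausdorff:
  "measure_space UNIV (lambda_system UNIV UNIV (hausdorff_outer k)) (hausdorff_outer k)"
  using sigma_algebra.caratheodory_lemma[OF sigma_algebra_Pow[of UNIV]] outer_measure_space_hausdorff
  by (metis Pow_UNIV)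

lemma sets_hausdorff:
  "sets (hausdorff k :: 'a::metric_space measure) = lambda_system UNIV UNIV (hausdorff_outer k)"
  using measure_space_hausdorff[where ?'a = 'a and k = k] unfolding hausdorff_def
  by (simp add: measure_space_def sigma_algebra.sigma_sets_eq)

lemma emeasure_hausdorff:
  fixes A :: "'a::metric_space set"
  assumes "A \<in> sets (hausdorff k)"
  shows "emeasure (hausdorff k) A = hausdorff_outer k A"
  using measure_space_hausdorff[where ?'a = 'a and k = k] assms
  unfolding sets_hausdorff by (simp add: hausdorff_def measure_space_def
      emeasure_measure_of_sigma)


section \<open>Rectifiable sets and approximate tangent planes\<close>

definition rectifiable :: "nat \<Rightarrow> 'a::euclidean_space set \<Rightarrow> bool" where
  "rectifiable n M \<longleftrightarrow>
     M \<in> sets (hausdorff n) \<and>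
     (\<exists>N :: nat \<Rightarrow> 'a set. (\<forall>i. submanifold 1 n (N i)) \<and> M - (\<Union>i. N i) \<in> null_sets (hausdorff n))"

text \<open>
  A rectifiable set need not have locally finite Hausdorff measure, so its approximate tangent
  planes are taken with respect to a positive, locally integrable weight \<open>w\<close> on \<open>M\<close> (Simon,
  Lectures on Geometric Measure Theory, Ch. 3). They exist almost everywhere, and for different
  weights they agree almost everywhere; if \<open>M\<close> has locally finite measure then \<open>w = 1\<close> is allowed.
\<close>

definition tangent_weight :: "nat \<Rightarrow> 'a::euclidean_space set \<Rightarrow> ('a \<Rightarrow> real) \<Rightarrow> bool" where
  "tangent_weight n M w \<longleftrightarrow>
     w \<in> borel_measurable (restrict_space (hausdorff n) M) \<and> (\<forall>x\<in>M. 0 < w x) \<and>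
     (\<forall>K. compact K \<longrightarrow> (\<integral>\<^sup>+x\<in>K \<inter> M. ennreal (w x) \<partial>hausdorff n) < \<infinity>)"

definition approx_tangent :: "nat \<Rightarrow> ('a::euclidean_space \<Rightarrow> real) \<Rightarrow> 'a set \<Rightarrow> 'a \<Rightarrow> 'a set \<Rightarrow> bool" where
  "approx_tangent n w M x P \<longleftrightarrow>
     x \<in> M \<and> subspace P \<and> dim P = n \<and>
     (\<forall>f :: 'a \<Rightarrow> real. continuous_on UNIV f \<and> compact (spt f) \<longrightarrow>
        ((\<lambda>r. (LINT y:M|hausdorff n. f ((y - x) /\<^sub>R r) * w y) / r ^ n)
           \<longlongrightarrow> w x * (LINT y:P|hausdorff n. f y)) (at_right 0))"

definition Tan :: "nat \<Rightarrow> ('a::euclidean_space \<Rightarrow> real) \<Rightarrow> 'a set \<Rightarrow> 'a \<Rightarrow> 'a set" where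
  "Tan n w M x = (SOME P. approx_tangent n w M x P)"

definition spacelike_rectifiable ::
    "nat \<Rightarrow> (('n::finite, 'm::finite) minkowski \<Rightarrow> real) \<Rightarrow> ('n, 'm) minkowski set \<Rightarrow> bool" where
  "spacelike_rectifiable n w M \<longleftrightarrow>
     rectifiable n M \<and> tangent_weight n M w \<and>
     (\<forall>x P. approx_tangent n w M x P \<longrightarrow> spacelike_subspace P)"

text \<open>\<open>T\<close> is the field of tangent planes; this is \<open>(\<theta> \<sigma>\<^sup>k \<llcorner> M) (A)\<close>.\<close>

definition sigma_weighted ::
    "nat \<Rightarrow> (('n::finite, 'm::finite) minkowski \<Rightarrow> ('n, 'm) minkowski set) \<Rightarrow> ('n, 'm) minkowski set \<Rightarrow>
     (('n, 'm) minkowski \<Rightarrow> nat) \<Rightarrow> ('n, 'm) minkowski set \<Rightarrow> ennreal" where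
  "sigma_weighted k T M \<theta> A = (\<integral>\<^sup>+x\<in>A \<inter> M. of_nat (\<theta> x) * ennreal (area_factor (T x)) \<partial>hausdorff k)"


section \<open>Spacelike integer rectifiable measures\<close>

definition radon_on :: "'a::euclidean_space set \<Rightarrow> 'a measure \<Rightarrow> bool" where
  "radon_on U \<mu> \<longleftrightarrow>
     sets \<mu> = sets (restrict_space borel U) \<and> (\<forall>K. compact K \<and> K \<subseteq> U \<longrightarrow> emeasure \<mu> K < \<infinity>)"

text \<open>Local integrability of \<open>\<theta>\<close> is part of \<open>\<mu>\<close> being Radon.\<close>

definition represents ::
    "('n::finite, 'm::finite) minkowski set \<Rightarrow> ('n, 'm) minkowski measure \<Rightarrow>
     ('n, 'm) minkowski set \<Rightarrow> (('n, 'm) minkowski \<Rightarrow> real) \<Rightarrow> (('n, 'm) minkowski \<Rightarrow> nat) \<Rightarrow> bool" where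
  "represents U \<mu> M w \<theta> \<longleftrightarrow>
     M \<subseteq> U \<and> spacelike_rectifiable CARD('n) w M \<and>
     \<theta> \<in> restrict_space (hausdorff CARD('n)) M \<rightarrow>\<^sub>M count_space UNIV \<and>
     (\<forall>A\<in>sets \<mu>. emeasure \<mu> A = sigma_weighted CARD('n) (Tan CARD('n) w M) M \<theta> A)"

definition spacelike_integer_rectifiable ::
    "('n::finite, 'm::finite) minkowski set \<Rightarrow> ('n, 'm) minkowski measure \<Rightarrow> bool" where
  "spacelike_integer_rectifiable U \<mu> \<longleftrightarrow> radon_on U \<mu> \<and> (\<exists>M w \<theta>. represents U \<mu> M w \<theta>)"

text \<open>
  \<open>Tan(\<mu>, x) = Tan(M, x)\<close> for a chosen representation of \<open>\<mu>\<close>; up to \<open>\<mu>\<close>-null sets it does not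
  depend on the choice.
\<close>

definition set_and_weight ::
    "('n::finite, 'm::finite) minkowski set \<Rightarrow> ('n, 'm) minkowski measure \<Rightarrow>
     ('n, 'm) minkowski set \<times> (('n, 'm) minkowski \<Rightarrow> real)" where
  "set_and_weight U \<mu> = (SOME (M, w). \<exists>\<theta>. represents U \<mu> M w \<theta>)"

definition has_tangent_plane ::
    "('n::finite, 'm::finite) minkowski set \<Rightarrow> ('n, 'm) minkowski measure \<Rightarrow> ('n, 'm) minkowski \<Rightarrow> bool" where
  "has_tangent_plane U \<mu> x \<longleftrightarrow>
     (case set_and_weight U \<mu> of (M, w) \<Rightarrow> \<exists>P. approx_tangent CARD('n) w M x P)"

definition tangent_plane ::
    "('n::finite, 'm::finite) minkowski set \<Rightarrow> ('n, 'm) minkowski measure \<Rightarrow> ('n, 'm) minkowski \<Rightarrow>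
     ('n, 'm) minkowski set" where
  "tangent_plane U \<mu> x = (case set_and_weight U \<mu> of (M, w) \<Rightarrow> Tan CARD('n) w M x)"


section \<open>First variation\<close>

definition lor_div ::
    "('n::finite, 'm::finite) minkowski set \<Rightarrow> ('n, 'm) minkowski measure \<Rightarrow>
     (('n, 'm) minkowski \<Rightarrow> ('n, 'm) minkowski) \<Rightarrow> ('n, 'm) minkowski \<Rightarrow> real" where
  "lor_div U \<mu> X x =
     (\<Sum>\<tau>\<in>(SOME B. lor_orthonormal_basis (tangent_plane U \<mu> x) B). lor \<tau> (frechet_derivative X (at x) \<tau>))"

text \<open>
  The tangent planes are measurable only up to \<open>\<mu>\<close>-null sets, hence the completion.
\<close>

definition first_variation ::
    "('n::finite, 'm::finite) minkowski set \<Rightarrow> ('n, 'm) minkowski measure \<Rightarrow>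
     (('n, 'm) minkowski \<Rightarrow> ('n, 'm) minkowski) \<Rightarrow> real" where
  "first_variation U \<mu> X = (LINT x|completion \<mu>. lor_div U \<mu> X x)"

text \<open>
  The divergence need not be a bounded function, since the tangent planes may degenerate. That
  its integral exists is required explicitly, so that the first variation is a linear functional.
\<close>

definition locally_bounded_first_variation ::
    "('n::finite, 'm::finite) minkowski set \<Rightarrow> ('n, 'm) minkowski measure \<Rightarrow> bool" where
  "locally_bounded_first_variation U \<mu> \<longleftrightarrow>
     (\<forall>X\<in>C1_c U. integrable (completion \<mu>) (lor_div U \<mu> X)) \<and>
     (\<forall>K. compact (closure K) \<and> closure K \<subseteq> U \<longrightarrow>
        (\<exists>c. \<forall>X\<in>C1_c U. spt X \<subseteq> K \<longrightarrow> \<bar>first_variation U \<mu> X\<bar> \<le> c * (SUP x\<in>K. norm (X x))))"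

text \<open>
  The Riesz representation \<open>(\<nu>, e) = (|\<delta>V|, \<eta>~)\<close> of the first variation and the decomposition
  \<open>\<nu> = f \<mu> + \<beta>\<close> with \<open>\<beta>\<close> singular to \<open>\<mu>\<close>. Both measures are determined by \<open>\<mu>\<close>, the function
  \<open>e\<close> up to \<open>\<nu>\<close>-null sets and \<open>f\<close> up to \<open>\<mu>\<close>-null sets.
\<close>

definition variation_data ::
    "('n::finite, 'm::finite) minkowski set \<Rightarrow> ('n, 'm) minkowski measure \<Rightarrow>
     ('n, 'm) minkowski measure \<Rightarrow> (('n, 'm) minkowski \<Rightarrow> ('n, 'm) minkowski) \<Rightarrow>
     (('n, 'm) minkowski \<Rightarrow> real) \<Rightarrow> ('n, 'm) minkowski measure \<Rightarrow> bool" where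
  "variation_data U \<mu> \<nu> e f \<beta> \<longleftrightarrow>
     radon_on U \<nu> \<and> e \<in> borel_measurable \<nu> \<and> (AE x in \<nu>. norm (e x) = 1) \<and>
     (\<forall>X\<in>C1_c U. first_variation U \<mu> X = (LINT x|\<nu>. X x \<bullet> e x)) \<and>
     radon_on U \<beta> \<and> f \<in> borel_measurable \<mu> \<and> (\<forall>x. 0 \<le> f x) \<and>
     (\<forall>A\<in>sets \<mu>. emeasure \<nu> A = (\<integral>\<^sup>+x\<in>A. ennreal (f x) \<partial>\<mu>) + emeasure \<beta> A) \<and>
     (\<exists>Z\<in>sets \<mu>. emeasure \<mu> Z = 0 \<and> emeasure \<beta> (U - Z) = 0)"

definition the_variation_data ::
    "('n::finite, 'm::finite) minkowski set \<Rightarrow> ('n, 'm) minkowski measure \<Rightarrow>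
     ('n, 'm) minkowski measure \<times> (('n, 'm) minkowski \<Rightarrow> ('n, 'm) minkowski) \<times>
     (('n, 'm) minkowski \<Rightarrow> real) \<times> ('n, 'm) minkowski measure" where
  "the_variation_data U \<mu> = (SOME (\<nu>, e, f, \<beta>). variation_data U \<mu> \<nu> e f \<beta>)"

definition mean_curvature ::
    "('n::finite, 'm::finite) minkowski set \<Rightarrow> ('n, 'm) minkowski measure \<Rightarrow>
     ('n, 'm) minkowski \<Rightarrow> ('n, 'm) minkowski" where
  "mean_curvature U \<mu> x = (case the_variation_data U \<mu> of (\<nu>, e, f, \<beta>) \<Rightarrow> - xi (f x *\<^sub>R e x))"

definition conormal ::
    "('n::finite, 'm::finite) minkowski set \<Rightarrow> ('n, 'm) minkowski measure \<Rightarrow>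
     ('n, 'm) minkowski \<Rightarrow> ('n, 'm) minkowski" where
  "conormal U \<mu> x = (case the_variation_data U \<mu> of (\<nu>, e, f, \<beta>) \<Rightarrow> xi (e x))"

definition boundary_measure ::
    "('n::finite, 'm::finite) minkowski set \<Rightarrow> ('n, 'm) minkowski measure \<Rightarrow> ('n, 'm) minkowski measure" where
  "boundary_measure U \<mu> = (case the_variation_data U \<mu> of (\<nu>, e, f, \<beta>) \<Rightarrow> \<beta>)"


section \<open>Spacelike Brakke flows\<close>

definition SV :: "('n::finite, 'm::finite) minkowski set \<Rightarrow> ('n, 'm) minkowski set \<Rightarrow> ('n, 'm) minkowski measure set" where
  "SV U \<Gamma> = {\<mu>.
     spacelike_integer_rectifiable U \<mu> \<and> locally_bounded_first_variation U \<mu> \<and>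
     (AE x in \<mu>. has_tangent_plane U \<mu> x \<and> mean_curvature U \<mu> x \<in> lor_perp (tangent_plane U \<mu> x)) \<and>
     (AE x in boundary_measure U \<mu>.
        conormal U \<mu> x \<in> lor_perp (tangent_space \<Gamma> x) \<and> spacelike_vector (conormal U \<mu> x)) \<and>
     (\<forall>A\<in>sets \<mu>.
        (\<integral>\<^sup>+x\<in>A. ennreal (sqrt (lor (conormal U \<mu> x) (conormal U \<mu> x))) \<partial>boundary_measure U \<mu>)
          \<le> sigma_weighted (CARD('n) - 1) (tangent_space \<Gamma>) \<Gamma> (\<lambda>_. 1) A)}"

definition brakke_integrand ::
    "('n::finite, 'm::finite) minkowski set \<Rightarrow> (real \<Rightarrow> ('n, 'm) minkowski measure) \<Rightarrow>
     (('n, 'm) minkowski \<times> real \<Rightarrow> real) \<Rightarrow> real \<Rightarrow> real" where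
  "brakke_integrand U \<mu> \<phi> t =
     (LINT x|\<mu> t. (let H = mean_curvature U (\<mu> t) x in
        - \<phi> (x, t) * lor H H + lor (lor_grad (\<lambda>y. \<phi> (y, t)) x) H + deriv (\<lambda>s. \<phi> (x, s)) t))"

text \<open>
  The last condition is \<open>\<mu>\<^sub>b(\<phi>) - \<mu>\<^sub>a(\<phi>) \<ge> \<integral>\<^sub>a\<^sup>b g\<close> for \<open>g\<close> the function \<open>brakke_integrand\<close>, with the
  integral of \<open>g\<close> split into those of its positive part \<open>ennreal (g t)\<close> and of its negative part
  \<open>ennreal (- g t)\<close>: the latter could be infinite, in which case nothing is claimed.
\<close>

definition spacelike_brakke_flow ::
    "('n::finite, 'm::finite) minkowski set \<Rightarrow> ('n, 'm) minkowski set \<Rightarrow> real set \<Rightarrow>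
     (real \<Rightarrow> ('n, 'm) minkowski measure) \<Rightarrow> bool" where
  "spacelike_brakke_flow U \<Gamma> I \<mu> \<longleftrightarrow>
     open U \<and> is_interval I \<and>
     spacelike_submanifold \<infinity> (CARD('n) - 1) \<Gamma> \<and> properly_embedded U \<Gamma> \<and>
     (\<forall>t\<in>I. radon_on U (\<mu> t)) \<and>
     (AE t in lebesgue. t \<in> I \<longrightarrow> \<mu> t \<in> SV U \<Gamma>) \<and>
     (\<forall>a b K. a \<le> b \<and> {a..b} \<subseteq> I \<and> compact K \<and> K \<subseteq> U \<longrightarrow>
        (\<integral>\<^sup>+t\<in>{a..b}. (\<integral>\<^sup>+x\<in>K.
            ennreal (1 - lor (mean_curvature U (\<mu> t) x) (mean_curvature U (\<mu> t) x)) \<partial>\<mu> t) \<partial>lebesgue) < \<infinity>) \<and>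
     (\<forall>a b. a \<le> b \<and> {a..b} \<subseteq> I \<longrightarrow> (\<forall>\<phi>\<in>C2_c_nonneg U a b.
        ennreal (LINT x|\<mu> a. \<phi> (x, a)) + (\<integral>\<^sup>+t\<in>{a..b}. ennreal (brakke_integrand U \<mu> \<phi> t) \<partial>lebesgue)
          \<le> ennreal (LINT x|\<mu> b. \<phi> (x, b)) + (\<integral>\<^sup>+t\<in>{a..b}. ennreal (- brakke_integrand U \<mu> \<phi> t) \<partial>lebesgue)))"

definition grad_fun_sq_at ::
    "('n::finite, 'm::finite) minkowski set \<Rightarrow> ('n, 'm) minkowski set \<Rightarrow> ('n, 'm) minkowski measure \<Rightarrow>
     ('n, 'm) minkowski \<Rightarrow> real" where
  "grad_fun_sq_at U \<Gamma> \<mu> x =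
     (if \<mu> \<in> SV U \<Gamma> \<and> has_tangent_plane U \<mu> x then grad_fun_sq (tangent_plane U \<mu> x)
      else real CARD('m))"

end

theory Submission
  imports Defs
begin

text \<open>
  Test the flow with the time-independent cutoff \<open>\<phi>\<^sub>R (x) = max 0 (1 - \<bar>x\<bar>\<^sub>E\<^sup>2 / R\<^sup>2)\<^sup>3\<close>, which
  satisfies \<open>\<bar>\<nabla>\<phi>\<^sub>R\<bar>\<^sub>E\<^sup>2 \<le> 36 \<phi>\<^sub>R / R\<^sup>2\<close>. Normal vectors \<open>H\<close> of a spacelike \<open>n\<close>-plane are timelike
  with \<open>\<bar>H\<bar>\<^sub>E\<^sup>2 \<le> - 2 v\<^sup>2 \<langle>H, H\<rangle>\<close>, so completing the square bounds the integrand
  \<open>- \<phi>\<^sub>R \<langle>H, H\<rangle> + \<langle>\<nabla>\<phi>\<^sub>R, H\<rangle>\<close> from below by \<open>- 18 v\<^sup>2 / R\<^sup>2\<close>. The error vanishes as \<open>R \<rightarrow> \<infinity>\<close>.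
\<close>

section \<open>The Lorentzian product on normal vectors\<close>

lemma sum_UNIV_Plus:
  fixes f :: "'a::finite + 'b::finite \<Rightarrow> 'c::comm_monoid_add"
  shows "sum f UNIV = (\<Sum>i\<in>UNIV. f (Inl i)) + (\<Sum>j\<in>UNIV. f (Inr j))"
  by (subst UNIV_Plus_UNIV[symmetric], subst sum.Plus) simp_all

text \<open>The diagonal reflection \<open>xi\<close> carries all the signs, so bilinearity of
  \<open>lor\<close> is inherited from the Euclidean inner product and the linearity of
  \<open>xi\<close>.\<close>

lemma lor_eq_inner: "lor u w = xi u \<bullet> w"
  by (simp add: inner_vec_def sum_UNIV_Plus lor_def xi_def sum_negf)

lemma xi_xi [simp]: "xi (xi u) = u"
  by (simp add: xi_def vec_eq_iff split: sum.split)

lemma linear_xi: "linear xi"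
  by (rule linearI) (simp_all add: xi_def vec_eq_iff split: sum.split)

lemma lor_commute: "lor u w = lor w u"
  by (simp add: lor_def mult.commute)

lemma lor_add_left: "lor (u + v) w = lor u w + lor v w"
  and lor_scaleR_left: "lor (c *\<^sub>R u) w = c * lor u w"
  by (simp_all add: lor_eq_inner linear_add[OF linear_xi]
      linear_cmul[OF linear_xi] inner_left_distrib)

lemma lor_add_right: "lor w (u + v) = lor w u + lor w v"
  and lor_diff_right: "lor w (u - v) = lor w u - lor w v"
  and lor_scaleR_right: "lor w (c *\<^sub>R u) = c * lor w u"
  by (simp_all add: lor_eq_inner inner_right_distrib inner_diff_right)

lemma subspace_lor_perp: "subspace (lor_perp P)"
  by (rule subspaceI)
    (simp_all add: lor_perp_def lor_add_left lor_scaleR_left, simp add: lor_eq_inner linear_0[OF linear_xi])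

lemma lor_axis_Inr: "lor u (axis (Inr j) 1) = - (u $ Inr j)"
  by (simp add: lor_eq_inner inner_axis' inner_commute xi_def inner_axis)

lemma norm_eq_lor_plus_time: "(norm u)\<^sup>2 = lor u u + 2 * (\<Sum>j\<in>UNIV. (u $ Inr j)\<^sup>2)"
  unfolding power2_norm_eq_inner
  by (simp add: inner_vec_def sum_UNIV_Plus lor_def power2_eq_square)

text \<open>A normal vector \<open>q\<close> of positive square would enlarge \<open>P\<close> to a
  positive definite subspace of dimension n + 1. The projection \<open>\<pi>\<close> to the n space
  coordinates is injective on such a subspace, since a vector in its kernel has only time
  coordinates and hence nonpositive square. This contradicts the dimension of the target.\<close>

lemma lor_perp_nonpos:
  fixes P :: "('n::finite, 'm::finite) minkowski set"
  assumes P: "spacelike_subspace P" "dim P = CARD('n)" and q: "q \<in> lor_perp P"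
  shows "lor q q \<le> 0"
proof (rule ccontr)
  assume "\<not> lor q q \<le> 0"
  then have pos: "lor q q > 0" by simp
  have sub: "subspace P" using P by (simp add: spacelike_subspace_def)
  have perp: "lor q p = 0" "lor p q = 0" if "p \<in> P" for p
    using q that by (simp_all add: lor_perp_def lor_commute[of p])
  let ?S = "insert q P"
  define \<pi> :: "('n, 'm) minkowski \<Rightarrow> real ^ 'n" where "\<pi> x = (\<chi> i. x $ Inl i)" for x
  have lin: "linear \<pi>"
    by (rule linearI) (simp_all add: \<pi>_def vec_eq_iff)
  have "inj_on \<pi> (span ?S)"
  proof (subst linear_inj_on_iff_eq_0[OF lin subspace_span], intro ballI impI)
    fix x assume x: "x \<in> span ?S" and 0: "\<pi> x = 0"
    obtain c where c: "x - c *\<^sub>R q \<in> P"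
      using x sub by (auto simp: span_breakdown_eq span_eq_iff[THEN iffD2])
    define p where "p = x - c *\<^sub>R q"
    have x_eq: "x = p + c *\<^sub>R q" and p: "p \<in> P" using c by (simp_all add: p_def)
    have "x $ Inl i = 0" for i
      using 0 by (simp add: \<pi>_def vec_eq_iff)
    then have "lor x x \<le> 0"
      by (simp add: lor_def sum_nonneg)
    moreover have "lor x x = lor p p + c\<^sup>2 * lor q q"
      using perp[OF p]
      by (simp add: x_eq lor_add_left lor_add_right lor_scaleR_left lor_scaleR_right power2_eq_square)
    moreover have "lor p p \<ge> 0" "p \<noteq> 0 \<Longrightarrow> lor p p > 0"
      using P p by (cases "p = 0"; auto simp: spacelike_subspace_def lor_eq_inner)+
    moreover have "c\<^sup>2 * lor q q \<ge> 0" "c \<noteq> 0 \<Longrightarrow> c\<^sup>2 * lor q q > 0"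
      using pos by simp_all
    ultimately have "p = 0" "c = 0"
      by force+
    then show "x = 0" by (simp add: x_eq)
  qed
  then have "dim (\<pi> ` ?S) = dim ?S"
    by (rule dim_image_eq[OF lin])
  \<comment> \<open>If \<open>q\<close> were in \<open>P\<close>, it would be orthogonal to
    itself.\<close>
  moreover have "q \<notin> span P"
    using perp(1)[of q] pos sub by (auto simp: span_eq_iff[THEN iffD2])
  then have "dim ?S = CARD('n) + 1"
    using P by (simp add: dim_insert)
  moreover have "dim (\<pi> ` ?S) \<le> CARD('n)"
    using dim_subset_UNIV[of "\<pi> ` ?S"] by simp
  ultimately show False by simp
qed

text \<open>Makes the definite description in \<open>perp_part\<close> meaningful. The map
  \<open>T\<close> records the pairings with a basis of \<open>P\<close>; being injective on
  \<open>P\<close>, it maps \<open>P\<close> onto \<open>P\<close> by dimension. Some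
  \<open>p\<close> in \<open>P\<close> therefore has \<open>T p = T u\<close>, and
  \<open>u - p\<close> is normal. Uniqueness holds because a vector of \<open>P\<close> that is also
  normal has square zero.\<close>

lemma perp_part:
  fixes P :: "('n::finite, 'm::finite) minkowski set"
  assumes "spacelike_subspace P"
  shows "perp_part P u \<in> lor_perp P" "u - perp_part P u \<in> P"
proof -
  have sub: "subspace P" and pos: "\<And>p. p \<in> P \<Longrightarrow> lor p p = 0 \<Longrightarrow> p = 0"
    using assms unfolding spacelike_subspace_def by force+
  obtain B where B: "B \<subseteq> P" "independent B" "P \<subseteq> span B" "card B = dim P"
    using basis_exists by blast
  have spanB: "span B = P"
    using B(1,3) sub by (metis span_mono span_eq_iff subset_antisym)
  have finB: "finite B" using B(2) by (rule independent_imp_finite)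
  \<comment> \<open>\<open>T\<close> is injective on \<open>P\<close>, since \<open>T p = 0\<close> forces \<open>\<langle>p, p\<rangle> = 0\<close>.\<close>
  define T where "T x = (\<Sum>b\<in>B. lor x b *\<^sub>R b)" for x
  have lin: "linear T"
    by (rule linearI)
      (simp_all add: T_def lor_add_left lor_scaleR_left scaleR_left_distrib sum.distrib scaleR_sum_right)
  have T_in: "T x \<in> P" for x
    unfolding T_def using B(1) sub by (auto intro!: subspace_sum subspace_scale)
  \<comment> \<open>The kernel of \<open>T\<close> consists of normal vectors: independence of
    \<open>B\<close> makes every coefficient vanish, and \<open>B\<close> spans
    \<open>P\<close>.\<close>
  have T0: "lor x p = 0" if "T x = 0" "p \<in> P" for x p
  proof -
    have "\<forall>b\<in>B. lor x b = 0"
      using that(1) B(2) finB unfolding T_def by (auto simp: independent_explicit)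
    moreover have "p \<in> span B" using that(2) spanB by simp
    then have "p \<in> {p. lor x p = 0}"
      using \<open>\<forall>b\<in>B. lor x b = 0\<close>
      by (induction rule: span_induct)
        (auto intro!: subspaceI simp: lor_add_right lor_scaleR_right, simp add: lor_eq_inner)
    then show ?thesis by simp
  qed
  have "inj_on T (span P)"
    using sub by (subst linear_inj_on_iff_eq_0[OF lin subspace_span])
      (auto simp: span_eq_iff[THEN iffD2] intro: pos T0)
  then have "dim (T ` P) = dim P"
    by (rule dim_image_eq[OF lin])
  then have "T ` P = P"
    using subspace_dim_equal[OF linear_subspace_image[OF lin sub] sub] T_in by auto
  then obtain p where p: "p \<in> P" "T u = T p"
    using T_in[of u] by (metis imageE)
  have ex: "u - p \<in> lor_perp P"
    using T0[of "u - p"] p(2) by (simp add: lor_perp_def linear_diff[OF lin])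
  have "\<exists>!q. q \<in> lor_perp P \<and> u - q \<in> P"
  proof (rule ex1I)
    show "u - p \<in> lor_perp P \<and> u - (u - p) \<in> P" using ex p by simp
  next
    fix q assume q: "q \<in> lor_perp P \<and> u - q \<in> P"
    have "(u - q) - p \<in> P" using q p(1) sub by (auto intro: subspace_diff)
    moreover have "(u - p) - q \<in> lor_perp P" using ex q by (auto intro: subspace_diff subspace_lor_perp)
    ultimately have "(u - p) - q = 0"
      by (intro pos) (simp_all add: lor_perp_def algebra_simps)
    then show "q = u - p" by simp
  qed
  from theI'[OF this] show "perp_part P u \<in> lor_perp P" "u - perp_part P u \<in> P"
    unfolding perp_part_def by auto
qed

text \<open>On the normal space \<open>- lor\<close> is positive semidefinite, so the usual
  discriminant argument applies. Definiteness is not at hand, hence the separate case of a null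
  vector \<open>e\<close>.\<close>

lemma lor_perp_Cauchy_Schwarz:
  fixes P :: "('n::finite, 'm::finite) minkowski set"
  assumes P: "spacelike_subspace P" "dim P = CARD('n)" and H: "H \<in> lor_perp P" and e: "e \<in> lor_perp P"
  shows "(lor H e)\<^sup>2 \<le> lor H H * lor e e"
proof -
  let ?A = "- lor H H" and ?B = "- lor e e" and ?C = "lor H e"
  have quad: "0 \<le> ?A * s\<^sup>2 - 2 * ?C * s * t + ?B * t\<^sup>2" for s t
  proof -
    have "s *\<^sub>R H + t *\<^sub>R e \<in> lor_perp P"
      using H e by (intro subspace_add subspace_scale subspace_lor_perp)
    from lor_perp_nonpos[OF P this] show ?thesis
      by (simp add: lor_add_left lor_add_right lor_scaleR_left lor_scaleR_right lor_commute[of e H]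
          power2_eq_square algebra_simps)
  qed
  show ?thesis
  proof (cases "?B = 0")
    case True
    have "?C = 0"
    proof (rule ccontr)
      assume "?C \<noteq> 0"
      \<comment> \<open>With \<open>?B = 0\<close> the form is linear in \<open>t\<close>; at this
        \<open>t\<close> it equals \<open>?A - (?A + 1) = -1\<close>.\<close>
      then show False
        using quad[of 1 "(?A + 1) / (2 * ?C)"] True by (simp add: field_simps)
    qed
    then show ?thesis using True by simp
  next
    case False
    then have B: "?B > 0" using lor_perp_nonpos[OF P e] by simp
    \<comment> \<open>The choice \<open>s = ?B\<close>, \<open>t = ?C\<close> minimises the form in
      \<open>t\<close> and leaves \<open>?B\<close> times the discriminant.\<close>
    have "0 \<le> ?B * (?A * ?B - ?C\<^sup>2)"
      using quad[of ?B ?C] by (simp add: power2_eq_square algebra_simps)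
    then have "0 \<le> ?A * ?B - ?C\<^sup>2"
      by (metis B mult_pos_neg not_le)
    then show ?thesis by simp
  qed
qed

lemma grad_fun_sq_nonneg:
  fixes P :: "('n::finite, 'm::finite) minkowski set"
  assumes "spacelike_subspace P" "dim P = CARD('n)"
  shows "0 \<le> grad_fun_sq P"
  unfolding grad_fun_sq_def
  using lor_perp_nonpos[OF assms perp_part(1)[OF assms(1)]] by (intro sum_nonneg) simp

text \<open>Each time coordinate of \<open>H\<close> is, up to sign, its pairing with a basis
  vector, and normality of \<open>H\<close> lets that vector be replaced by its normal part.
  Cauchy-Schwarz and summation produce \<open>grad_fun_sq P\<close>. The factor 2 is that of
  \<open>norm_eq_lor_plus_time\<close>, where the nonpositive term \<open>lor H H\<close> is
  dropped.\<close>

lemma norm_lor_perp_le: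
  fixes P :: "('n::finite, 'm::finite) minkowski set"
  assumes P: "spacelike_subspace P" "dim P = CARD('n)" and H: "H \<in> lor_perp P"
  shows "(norm H)\<^sup>2 \<le> 2 * grad_fun_sq P * (- lor H H)"
proof -
  have "(H $ Inr j)\<^sup>2 \<le> - lor H H * - lor (perp_part P (axis (Inr j) 1)) (perp_part P (axis (Inr j) 1))"
    for j
  proof -
    let ?e = "axis (Inr j) 1 :: ('n, 'm) minkowski"
    have "lor H (?e - perp_part P ?e) = 0"
      using H perp_part(2)[OF P(1), of ?e] by (simp add: lor_perp_def)
    then have "lor H (perp_part P ?e) = - (H $ Inr j)"
      by (simp add: lor_diff_right lor_axis_Inr)
    with lor_perp_Cauchy_Schwarz[OF P H perp_part(1)[OF P(1), of ?e]] show ?thesis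
      by simp
  qed
  then have "(\<Sum>j\<in>UNIV. (H $ Inr j)\<^sup>2) \<le> - lor H H * grad_fun_sq P"
    unfolding grad_fun_sq_def sum_distrib_left by (intro sum_mono)
  then show ?thesis
    using lor_perp_nonpos[OF P H] norm_eq_lor_plus_time[of H] by (simp add: algebra_simps)
qed

text \<open>The witness is \<open>xi\<close> applied to the Euclidean gradient
  \<open>adjoint ?D 1\<close>.\<close>

lemma lor_lor_grad:
  assumes "f differentiable at x"
  shows "lor (lor_grad f x) v = frechet_derivative f (at x) v"
proof -
  let ?D = "frechet_derivative f (at x)"
  have lin: "linear ?D" using assms by (rule linear_frechet_derivative)
  have "\<exists>!g. \<forall>v. lor g v = ?D v"
  proof (rule ex1I[of _ "xi (adjoint ?D 1)"])
    show "\<forall>v. lor (xi (adjoint ?D 1)) v = ?D v"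
      using adjoint_works[OF lin, of _ 1] by (simp add: lor_eq_inner inner_commute)
  next
    fix g assume "\<forall>v. lor g v = ?D v"
    then have "\<forall>v. v \<bullet> xi g = v \<bullet> adjoint ?D 1"
      using adjoint_works[OF lin, of _ 1] by (simp add: lor_eq_inner inner_commute)
    then have "xi g = adjoint ?D 1" by (metis vector_eq_ldot)
    then show "g = xi (adjoint ?D 1)" by (metis xi_xi)
  qed
  from theI'[OF this] show ?thesis unfolding lor_grad_def by blast
qed

section \<open>The cutoff function\<close>

text \<open>The third power makes the truncation at the sphere of radius \<open>R\<close> twice
  continuously differentiable, as \<open>C2_c_nonneg\<close> requires.\<close>

definition cutoff :: "real \<Rightarrow> 'a::euclidean_space \<Rightarrow> real" where
  "cutoff R x = max 0 (1 - (x \<bullet> x) / R\<^sup>2) ^ 3"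

text \<open>An exponent of at least 2 removes the kink: at 0 the difference quotient is at most
  \<open>\<bar>h\<bar> ^ Suc k\<close> in absolute value. The instances used below are
  \<open>k = 1\<close> for the cutoff and \<open>k = 0\<close> for its derivative.\<close>

lemma has_real_derivative_max_0_power:
  "((\<lambda>u::real. max 0 u ^ Suc (Suc k)) has_real_derivative real (Suc (Suc k)) * max 0 u ^ Suc k) (at u)"
proof -
  consider "u < 0" | "u = 0" | "u > 0" by linarith
  then show ?thesis
  proof cases
    case 1
    then have "\<forall>\<^sub>F v in nhds u. max 0 v ^ Suc (Suc k) = (0::real)"
      using eventually_nhds_in_open[of "{..<0}" u]
      by (auto elim!: eventually_mono simp: max_def)
    then show ?thesis
      using 1 by (subst DERIV_cong_ev[OF refl _ refl, where g = "\<lambda>_. 0"]) auto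
  next
    case 2
    have "((\<lambda>h::real. h ^ Suc k) \<longlongrightarrow> 0) (at 0)"
      by (rule tendsto_eq_intros refl | simp)+
    then have "((\<lambda>h::real. max 0 h ^ Suc (Suc k) / h) \<longlongrightarrow> 0) (at 0)"
      by (rule Lim_null_comparison[rotated, OF tendsto_rabs_zero])
        (auto simp: eventually_at_filter max_def power_abs abs_mult intro!: always_eventually mult_nonpos_nonneg)
    then show ?thesis
      using 2 by (simp add: DERIV_def)
  next
    case 3
    then have "\<forall>\<^sub>F v in nhds u. max 0 v ^ Suc (Suc k) = v ^ Suc (Suc k)"
      using eventually_nhds_in_open[of "{0<..}" u]
      by (auto elim!: eventually_mono simp: max_def)
    moreover have "((\<lambda>v. v ^ Suc (Suc k)) has_real_derivative real (Suc (Suc k)) * max 0 u ^ Suc k) (at u)"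
      using 3 DERIV_pow[of "Suc (Suc k)" u] by (simp add: max_def)
    ultimately show ?thesis
      by (subst DERIV_cong_ev[OF refl _ refl]) auto
  qed
qed

lemma has_derivative_max_0_power:
  assumes "(f has_derivative f') (at x)"
  shows "((\<lambda>x. max 0 (f x) ^ Suc (Suc k) :: real) has_derivative
    (\<lambda>v. real (Suc (Suc k)) * max 0 (f x) ^ Suc k * f' v)) (at x)"
  using has_derivative_compose[OF assms
      has_real_derivative_max_0_power[of k "f x", unfolded has_field_derivative_def]]
  by simp

lemma frechet_derivativeI: "(f has_derivative f') (at x) \<Longrightarrow> frechet_derivative f (at x) = f'"
  by (rule frechet_derivative_at[symmetric])

lemma has_derivative_cutoff:
  "(cutoff R has_derivative (\<lambda>v. - 6 / R\<^sup>2 * max 0 (1 - (x \<bullet> x) / R\<^sup>2) ^ 2 * (x \<bullet> v))) (at x)"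
proof -
  have "((\<lambda>x. 1 - inverse (R\<^sup>2) * (x \<bullet> x)) has_derivative (\<lambda>v. - 2 * inverse (R\<^sup>2) * (x \<bullet> v))) (at x)"
    by (rule derivative_eq_intros refl)+ (simp add: fun_eq_iff inner_commute)
  from has_derivative_max_0_power[OF this, of 1] show ?thesis
    by (simp add: cutoff_def[abs_def] numeral_3_eq_3 numeral_2_eq_2 divide_inverse mult_ac)
qed

text \<open>Stated on space-time because test functions depend on \<open>(x, t)\<close>. The first
  and second directional derivatives are the explicit \<open>?f1\<close> and \<open>?f2\<close>;
  every term of \<open>?f2\<close> keeps a factor \<open>max 0 (u z)\<close>, and continuity is all
  that is needed of it.\<close>

lemma C_on_cutoff: "C_on 2 UNIV (\<lambda>z :: 'a::euclidean_space \<times> real. cutoff R (fst z))"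
proof -
  define u where "u z = 1 - (fst z \<bullet> fst z) / R\<^sup>2" for z :: "'a \<times> real"
  have cont_u: "continuous_on UNIV u"
    unfolding u_def divide_inverse by (intro continuous_intros)
  have u': "(u has_derivative (\<lambda>w. - 2 / R\<^sup>2 * (fst z \<bullet> fst w))) (at z)" for z
  proof -
    have "((\<lambda>z. 1 - inverse (R\<^sup>2) * (fst z \<bullet> fst z)) has_derivative
        (\<lambda>w. - 2 / R\<^sup>2 * (fst z \<bullet> fst w))) (at z)"
      by (rule derivative_eq_intros refl)+ (simp add: fun_eq_iff inner_commute divide_inverse)
    then show ?thesis by (simp add: u_def[abs_def] divide_inverse mult_ac)
  qed
  let ?f = "\<lambda>z :: 'a \<times> real. cutoff R (fst z) :: real"
  let ?f1 = "\<lambda>(v :: 'a \<times> real) z. - 6 / R\<^sup>2 * max 0 (u z) ^ 2 * (fst z \<bullet> fst v)"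
  let ?f2 = "\<lambda>(v :: 'a \<times> real) (w :: 'a \<times> real) z. - 6 / R\<^sup>2 *
    (max 0 (u z) ^ 2 * (fst w \<bullet> fst v) + 2 * max 0 (u z) * (- 2 / R\<^sup>2 * (fst z \<bullet> fst w)) * (fst z \<bullet> fst v))"
  have 1: "(?f has_derivative (\<lambda>v. ?f1 v z)) (at z)" for z
    using has_derivative_compose[OF has_derivative_fst[OF has_derivative_ident] has_derivative_cutoff,
        of R z UNIV]
    by (simp add: u_def)
  have 2: "(?f1 v has_derivative (\<lambda>w. ?f2 v w z)) (at z)" for v z
  proof -
    have "((\<lambda>z. max 0 (u z) ^ 2) has_derivative
        (\<lambda>w. 2 * max 0 (u z) * (- 2 / R\<^sup>2 * (fst z \<bullet> fst w)))) (at z)"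
      using has_derivative_max_0_power[OF u', of 0 z] by (simp add: numeral_2_eq_2)
    moreover have "((\<lambda>z. fst z \<bullet> fst v) has_derivative (\<lambda>w. fst w \<bullet> fst v)) (at z)"
      by (rule derivative_eq_intros refl)+ simp
    ultimately have "((\<lambda>z. max 0 (u z) ^ 2 * (fst z \<bullet> fst v)) has_derivative
        (\<lambda>w. max 0 (u z) ^ 2 * (fst w \<bullet> fst v)
          + 2 * max 0 (u z) * (- 2 / R\<^sup>2 * (fst z \<bullet> fst w)) * (fst z \<bullet> fst v))) (at z)"
      by (rule has_derivative_mult)
    from has_derivative_mult_right[OF this, of "- 6 / R\<^sup>2"] show ?thesis
      by (simp only: mult.assoc)
  qed
  have F1: "(\<lambda>z. frechet_derivative ?f (at z) v) = ?f1 v" for v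
    by (simp add: frechet_derivativeI[OF 1] fun_eq_iff)
  have F2: "(\<lambda>z. frechet_derivative (?f1 v) (at z) w) = ?f2 v w" for v w
    by (simp only: frechet_derivativeI[OF 2])
  have cont0: "continuous_on UNIV ?f"
    unfolding cutoff_def divide_inverse by (intro continuous_intros)
  have cont1: "continuous_on UNIV (?f1 v)" and cont2: "continuous_on UNIV (?f2 v w)" for v w
    by (intro continuous_intros cont_u)+
  have d1: "?f differentiable_on UNIV"
    unfolding differentiable_on_def by (intro ballI differentiableI) (rule 1)
  have d2: "?f1 v differentiable_on UNIV" for v
    unfolding differentiable_on_def by (intro ballI differentiableI) (rule 2)
  have c0: "C_nat_on 0 UNIV ?f"
    using cont0 by (simp only: C_nat_on.simps)
  have c1: "C_nat_on (Suc 0) UNIV ?f"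
    unfolding C_nat_on.simps F1 using cont1 d1 by blast
  have c2: "C_nat_on (Suc (Suc 0)) UNIV ?f"
    unfolding C_nat_on.simps F1 F2 using cont2 d1 d2 by blast
  show ?thesis
    unfolding C_on_def
  proof (intro allI impI)
    fix k assume "enat k \<le> 2"
    then have "k \<le> 2" by (metis enat_ord_simps(1) numeral_eq_enat)
    then have "k = 0 \<or> k = Suc 0 \<or> k = Suc (Suc 0)" by linarith
    then show "C_nat_on k UNIV ?f" using c0 c1 c2 by blast
  qed
qed

lemma cutoff_nonneg: "0 \<le> cutoff R x" and cutoff_le_1: "cutoff R x \<le> 1"
  by (auto simp: cutoff_def intro!: power_le_one)

lemma cutoff_outside:
  assumes "0 < R" "x \<notin> cball 0 R"
  shows "cutoff R x = 0"
proof -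
  have "R\<^sup>2 < (norm x)\<^sup>2" using assms by (simp add: power_strict_mono)
  then show ?thesis
    using assms by (simp add: cutoff_def power2_norm_eq_inner field_simps)
qed

lemma C2_c_nonneg_cutoff:
  assumes "0 < R"
  shows "(\<lambda>z. cutoff R (fst z)) \<in> C2_c_nonneg UNIV a b"
  unfolding C2_c_nonneg_def
  using C_on_cutoff cutoff_outside[OF assms]
  by (auto simp: cutoff_nonneg intro!: exI[of _ "cball 0 R"])

lemma cutoff_tendsto_1: "(\<lambda>N. cutoff (real (Suc N)) x) \<longlonglongrightarrow> 1"
proof -
  have "(\<lambda>N. max 0 (1 - (x \<bullet> x) * (inverse (real (Suc N)))\<^sup>2) ^ 3) \<longlonglongrightarrow> max 0 (1 - (x \<bullet> x) * 0\<^sup>2) ^ 3"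
    by (intro tendsto_intros LIMSEQ_inverse_real_of_nat)
  then show ?thesis
    by (simp add: cutoff_def divide_inverse power_inverse)
qed

text \<open>The left side is minus the integrand of the flow inequality. The constant 18 is the one
  for which four times the product of \<open>s ^ 3 * h\<^sup>2\<close> and
  \<open>18 / R\<^sup>2 * v\<^sup>2\<close> equals the bound on the squared gradient term.\<close>

lemma cutoff_integrand_lower_bound:
  fixes P :: "('n::finite, 'm::finite) minkowski set"
  assumes P: "spacelike_subspace P" "dim P = CARD('n)" and H: "H \<in> lor_perp P" and R: "0 < R"
  shows "cutoff R x * lor H H - lor (lor_grad (cutoff R) x) H \<le> 18 / R\<^sup>2 * grad_fun_sq P"
proof -
  define s where "s = max 0 (1 - (x \<bullet> x) / R\<^sup>2)"
  define h where "h = sqrt (- lor H H)"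
  define v where "v = sqrt (grad_fun_sq P)"
  have h2: "h\<^sup>2 = - lor H H" using lor_perp_nonpos[OF P H] by (simp add: h_def)
  have v2: "v\<^sup>2 = grad_fun_sq P" using grad_fun_sq_nonneg[OF P] by (simp add: v_def)
  have s: "0 \<le> s" "s \<le> 1" by (simp_all add: s_def)
  \<comment> \<open>Pairing the Lorentzian gradient by \<open>lor\<close> returns the plain
    derivative, so the Euclidean product with \<open>H\<close> appears and the Euclidean bound on
    \<open>H\<close> applies.\<close>
  have grad: "lor (lor_grad (cutoff R) x) H = - 6 / R\<^sup>2 * s\<^sup>2 * (x \<bullet> H)"
    using has_derivative_cutoff[of R x]
    by (subst lor_lor_grad) (auto simp: frechet_derivativeI s_def differentiable_def)
  have "(norm H)\<^sup>2 \<le> 2 * v\<^sup>2 * h\<^sup>2"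
    using norm_lor_perp_le[OF P H] by (simp add: h2 v2)
  then have xH: "(x \<bullet> H)\<^sup>2 \<le> (norm x)\<^sup>2 * (2 * v\<^sup>2 * h\<^sup>2)"
    using Cauchy_Schwarz_ineq[of x H]
    by (simp add: power2_norm_eq_inner) (meson inner_ge_zero mult_left_mono order_trans)
  have key: "6 / R\<^sup>2 * s\<^sup>2 * (x \<bullet> H) \<le> s ^ 3 * h\<^sup>2 + 18 / R\<^sup>2 * v\<^sup>2"
  \<comment> \<open>The bound of the norm of \<open>x\<close> by \<open>R\<close> comes from
    \<open>s\<close> being nonzero; for \<open>s = 0\<close> the left side vanishes.\<close>
  proof (cases "s = 0")
    case True
    then show ?thesis by simp
  next
    case False
    then have "1 - (x \<bullet> x) / R\<^sup>2 \<ge> 0"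
      by (simp add: s_def max_def split: if_splits)
    then have x: "(norm x)\<^sup>2 \<le> R\<^sup>2"
      using R by (simp add: power2_norm_eq_inner field_simps)
    \<comment> \<open>The right-hand side is at least \<open>2 \<surd>(18 s\<^sup>3 h\<^sup>2 v\<^sup>2 / R\<^sup>2)\<close>; compare squares.\<close>
    have "(6 / R\<^sup>2 * s\<^sup>2 * (x \<bullet> H))\<^sup>2 = 36 / R ^ 4 * s ^ 4 * (x \<bullet> H)\<^sup>2"
      by (simp add: power_mult_distrib power_divide flip: power_mult)
    also have "\<dots> \<le> 36 / R ^ 4 * s ^ 4 * (R\<^sup>2 * (2 * v\<^sup>2 * h\<^sup>2))"
      using xH x by (intro mult_left_mono order_trans[OF xH] mult_right_mono) simp_all
    \<comment> \<open>Giving up one factor \<open>s \<le> 1\<close> matches the third power in the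
      cutoff.\<close>
    also have "\<dots> \<le> 36 / R ^ 4 * s ^ 3 * (R\<^sup>2 * (2 * v\<^sup>2 * h\<^sup>2))"
      using s power_decreasing[of 3 4 s] by (intro mult_left_mono mult_right_mono) simp_all
    also have "\<dots> = 4 * (s ^ 3 * h\<^sup>2) * (18 / R\<^sup>2 * v\<^sup>2)"
      using R by (simp add: field_simps power2_eq_square power4_eq_xxxx)
    also have "\<dots> \<le> (s ^ 3 * h\<^sup>2 + 18 / R\<^sup>2 * v\<^sup>2)\<^sup>2"
    proof -
      have "4 * p * q \<le> (p + q)\<^sup>2" for p q :: real
        using zero_le_power2[of "p - q"] by (simp add: power2_eq_square algebra_simps)
      then show ?thesis .
    qed
    finally show ?thesis
      by (rule power2_le_imp_le) (use s in simp)
  qed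
  have "cutoff R x = s ^ 3" by (simp add: cutoff_def s_def)
  then show ?thesis
    using key h2 by (simp add: grad v2)
qed

section \<open>Tangent planes and Radon measures\<close>

text \<open>Both \<open>set_and_weight\<close> and \<open>Tan\<close> are choices. A representation
  and a tangent plane exist, so the chosen ones are genuine, and \<open>represents\<close> makes
  every approximate tangent plane spacelike.\<close>

lemma tangent_plane_spacelike:
  fixes \<mu> :: "('n::finite, 'm::finite) minkowski measure"
  assumes "spacelike_integer_rectifiable U \<mu>" "has_tangent_plane U \<mu> x"
  shows "spacelike_subspace (tangent_plane U \<mu> x)" "dim (tangent_plane U \<mu> x) = CARD('n)"
proof -
  obtain M w where Mw: "set_and_weight U \<mu> = (M, w)" by force
  have "\<exists>p. case p of (M, w) \<Rightarrow> \<exists>\<theta>. represents U \<mu> M w \<theta>"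
    using assms(1) by (auto simp: spacelike_integer_rectifiable_def)
  from someI_ex[OF this] have "case set_and_weight U \<mu> of (M, w) \<Rightarrow> \<exists>\<theta>. represents U \<mu> M w \<theta>"
    by (simp only: set_and_weight_def)
  then have "\<exists>\<theta>. represents U \<mu> M w \<theta>"
    using Mw by simp
  moreover have "approx_tangent CARD('n) w M x (tangent_plane U \<mu> x)"
    using assms(2) Mw unfolding has_tangent_plane_def tangent_plane_def Tan_def
    by (auto intro: someI_ex)
  ultimately show "spacelike_subspace (tangent_plane U \<mu> x)" "dim (tangent_plane U \<mu> x) = CARD('n)"
    by (auto simp: represents_def spacelike_rectifiable_def approx_tangent_def)
qed

lemma radon_on_UNIV:
  assumes "radon_on UNIV \<mu>"
  shows "sets \<mu> = sets borel" "space \<mu> = UNIV"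
proof -
  show "sets \<mu> = sets borel" using assms by (simp add: radon_on_def)
  from sets_eq_imp_space_eq[OF this] show "space \<mu> = UNIV" by simp
qed

lemma borel_measurable_cutoff:
  assumes "radon_on UNIV \<mu>"
  shows "cutoff R \<in> borel_measurable \<mu>"
  unfolding measurable_cong_sets[OF radon_on_UNIV(1)[OF assms] refl] cutoff_def[abs_def]
  by measurable

lemma integrable_cutoff:
  assumes \<mu>: "radon_on UNIV \<mu>" and "0 < R"
  shows "integrable \<mu> (cutoff R)"
proof (rule Bochner_Integration.integrable_bound)
  show "integrable \<mu> (indicator (cball 0 R) :: _ \<Rightarrow> real)"
    using \<mu> radon_on_UNIV[OF \<mu>] by (auto simp: radon_on_def intro!: integrable_real_indicator)
  show "AE x in \<mu>. norm (cutoff R x) \<le> norm (indicator (cball 0 R) x :: real)"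
    by (auto intro!: AE_I2
        simp: indicator_def abs_of_nonneg[OF cutoff_nonneg] cutoff_le_1 cutoff_outside[OF assms(2)])
qed (rule borel_measurable_cutoff[OF \<mu>])

text \<open>
  Measurability of \<open>v\<^sup>2\<close> is not at hand, so the factor is pulled out of the integral, which is a
  lower integral on functions that are not measurable, directly.
\<close>

lemma nn_integral_cmult_le:
  fixes f :: "'a \<Rightarrow> ennreal"
  assumes "0 < c"
  shows "(\<integral>\<^sup>+x. ennreal c * f x \<partial>M) \<le> ennreal c * (\<integral>\<^sup>+x. f x \<partial>M)"
  unfolding nn_integral_def[of M "\<lambda>x. ennreal c * f x"]
proof (rule SUP_least, clarify)
  fix g assume g: "simple_function M g" and le: "g \<le> (\<lambda>x. ennreal c * f x)"
  have c: "ennreal c * ennreal (1 / c) = 1"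
    using assms by (simp flip: ennreal_mult)
  have "ennreal (1 / c) * g x \<le> f x" for x
  proof -
    have "ennreal (1 / c) * g x \<le> ennreal (1 / c) * (ennreal c * f x)"
      using le by (intro mult_left_mono) (auto simp: le_fun_def)
    also have "\<dots> = (ennreal c * ennreal (1 / c)) * f x"
      by (simp only: mult_ac)
    also have "\<dots> = f x"
      by (simp only: c mult_1)
    finally show ?thesis .
  qed
  \<comment> \<open>The simple function \<open>g\<close> is measurable, so here the constant may be
    moved across the integral.\<close>
  moreover have "integral\<^sup>S M g = ennreal c * (\<integral>\<^sup>+x. ennreal (1 / c) * g x \<partial>M)"
    using g c by (simp add: nn_integral_cmult nn_integral_eq_simple_integral borel_measurable_simple_function
        flip: mult.assoc)
  ultimately show "integral\<^sup>S M g \<le> ennreal c * (\<integral>\<^sup>+x. f x \<partial>M)"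
    by (auto intro!: mult_left_mono nn_integral_mono)
qed

text \<open>No integrability is assumed: the Bochner integral of a non-integrable function is 0.
  Otherwise \<open>f\<close> is compared with its positive part, which is what
  \<open>ennreal\<close> keeps.\<close>

lemma ennreal_integral_le_nn_integral: "ennreal (LINT x|M. f x) \<le> (\<integral>\<^sup>+x. ennreal (f x) \<partial>M)"
proof (cases "integrable M f")
  case True
  have "ennreal (LINT x|M. f x) \<le> ennreal (LINT x|M. max 0 (f x))"
    using True by (intro ennreal_leI integral_mono) auto
  also have "\<dots> = (\<integral>\<^sup>+x. ennreal (max 0 (f x)) \<partial>M)"
    using True by (intro nn_integral_eq_integral[symmetric]) auto
  also have "\<dots> = (\<integral>\<^sup>+x. ennreal (f x) \<partial>M)"
    by (intro nn_integral_cong) (simp add: max_def ennreal_neg)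
  finally show ?thesis .
qed (simp add: not_integrable_integral_eq)

section \<open>Monotonicity of the area\<close>

text \<open>Integrates the pointwise bound at a single time, for the negative part that stands on
  the right of the flow inequality.\<close>

lemma brakke_integrand_cutoff_lower_bound:
  fixes \<mu> :: "real \<Rightarrow> ('n::finite, 'm::finite) minkowski measure"
  assumes SV: "\<mu> t \<in> SV U \<Gamma>" and R: "0 < R"
  shows "ennreal (- brakke_integrand U \<mu> (\<lambda>z. cutoff R (fst z)) t)
    \<le> ennreal (18 / R\<^sup>2) * (\<integral>\<^sup>+x. ennreal (grad_fun_sq_at U \<Gamma> (\<mu> t) x) \<partial>\<mu> t)"
proof -
  let ?H = "mean_curvature U (\<mu> t)"
  let ?G = "\<lambda>x. - cutoff R x * lor (?H x) (?H x) + lor (lor_grad (cutoff R) x) (?H x)"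
  \<comment> \<open>The cutoff does not depend on time, so the \<open>deriv\<close> term is
    zero.\<close>
  have int: "brakke_integrand U \<mu> (\<lambda>z. cutoff R (fst z)) t = (LINT x|\<mu> t. ?G x)"
    by (simp add: brakke_integrand_def Let_def)
  have rect: "spacelike_integer_rectifiable U (\<mu> t)"
    using SV by (simp add: SV_def)
  have "AE x in \<mu> t. has_tangent_plane U (\<mu> t) x \<and> ?H x \<in> lor_perp (tangent_plane U (\<mu> t) x)"
    using SV by (simp add: SV_def)
  then have "AE x in \<mu> t. ennreal (- ?G x) \<le> ennreal (18 / R\<^sup>2) * ennreal (grad_fun_sq_at U \<Gamma> (\<mu> t) x)"
  proof eventually_elim
    case (elim x)
    then have "grad_fun_sq_at U \<Gamma> (\<mu> t) x = grad_fun_sq (tangent_plane U (\<mu> t) x)"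
      using SV by (simp add: grad_fun_sq_at_def)
    moreover note P = tangent_plane_spacelike[OF rect, of x]
    ultimately show ?case
      using cutoff_integrand_lower_bound[OF P _ R, of "?H x" x] grad_fun_sq_nonneg[OF P] elim
      by (auto simp flip: ennreal_mult intro!: ennreal_leI)
  qed
  then have "(\<integral>\<^sup>+x. ennreal (- ?G x) \<partial>\<mu> t)
      \<le> ennreal (18 / R\<^sup>2) * (\<integral>\<^sup>+x. ennreal (grad_fun_sq_at U \<Gamma> (\<mu> t) x) \<partial>\<mu> t)"
    using R by (intro order_trans[OF nn_integral_mono_AE nn_integral_cmult_le]) auto
  then show ?thesis
    unfolding int using ennreal_integral_le_nn_integral[of "\<mu> t" "\<lambda>x. - ?G x"]
    unfolding Bochner_Integration.integral_minus by (rule order_trans[rotated])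
qed

lemma brakke_inequality:
  assumes "spacelike_brakke_flow U \<Gamma> I \<mu>" "a \<le> b" "{a..b} \<subseteq> I" "\<phi> \<in> C2_c_nonneg U a b"
  shows "ennreal (LINT x|\<mu> a. \<phi> (x, a)) + (\<integral>\<^sup>+t\<in>{a..b}. ennreal (brakke_integrand U \<mu> \<phi> t) \<partial>lebesgue)
    \<le> ennreal (LINT x|\<mu> b. \<phi> (x, b)) + (\<integral>\<^sup>+t\<in>{a..b}. ennreal (- brakke_integrand U \<mu> \<phi> t) \<partial>lebesgue)"
  using assms by (simp add: spacelike_brakke_flow_def)

theorem corollary19:
  fixes \<mu> :: "real \<Rightarrow> ('n::finite, 'm::finite) minkowski measure"
    and \<Gamma> :: "('n, 'm) minkowski set" and I :: "real set" and a b :: real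
  assumes "spacelike_brakke_flow UNIV \<Gamma> I \<mu>"
    and "a \<le> b" and "{a..b} \<subseteq> I"
    and "(\<integral>\<^sup>+t\<in>{a..b}. (\<integral>\<^sup>+x. ennreal (grad_fun_sq_at UNIV \<Gamma> (\<mu> t) x) \<partial>\<mu> t) \<partial>lebesgue) < \<infinity>"
  shows "(\<integral>\<^sup>+x. 1 \<partial>\<mu> b) \<ge> (\<integral>\<^sup>+x. 1 \<partial>\<mu> a)"
proof -
  define V where
    "V = (\<integral>\<^sup>+t\<in>{a..b}. (\<integral>\<^sup>+x. ennreal (grad_fun_sq_at UNIV \<Gamma> (\<mu> t) x) \<partial>\<mu> t) \<partial>lebesgue)"
  have rad: "radon_on UNIV (\<mu> a)" "radon_on UNIV (\<mu> b)"
    using assms by (auto simp: spacelike_brakke_flow_def)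
  \<comment> \<open>The error is a fixed quantity \<open>V\<close> times a factor that tends to 0 as
    \<open>R\<close> grows.\<close>
  have est: "(\<integral>\<^sup>+x. ennreal (cutoff R x) \<partial>\<mu> a) \<le> (\<integral>\<^sup>+x. 1 \<partial>\<mu> b) + ennreal (18 / R\<^sup>2) * V"
    if R: "0 < R" for R
  proof -
    let ?\<phi> = "\<lambda>z. cutoff R (fst z)"
    let ?g = "brakke_integrand UNIV \<mu> ?\<phi>"
    have "AE t in lebesgue. t \<in> I \<longrightarrow> \<mu> t \<in> SV UNIV \<Gamma>"
      using assms(1) by (auto simp: spacelike_brakke_flow_def)
    then have "AE t in lebesgue. ennreal (- ?g t) * indicator {a..b} t \<le> ennreal (18 / R\<^sup>2) *
        ((\<integral>\<^sup>+x. ennreal (grad_fun_sq_at UNIV \<Gamma> (\<mu> t) x) \<partial>\<mu> t) * indicator {a..b} t)"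
      by eventually_elim
        (use brakke_integrand_cutoff_lower_bound[OF _ R] assms(3) in \<open>auto simp: indicator_def\<close>)
    then have neg: "(\<integral>\<^sup>+t\<in>{a..b}. ennreal (- ?g t) \<partial>lebesgue) \<le> ennreal (18 / R\<^sup>2) * V"
      unfolding V_def using R by (intro order_trans[OF nn_integral_mono_AE nn_integral_cmult_le]) auto
    have "(\<integral>\<^sup>+x. ennreal (cutoff R x) \<partial>\<mu> a) = ennreal (LINT x|\<mu> a. ?\<phi> (x, a))"
      using integrable_cutoff[OF rad(1) R] by (simp add: nn_integral_eq_integral cutoff_nonneg)
    \<comment> \<open>The positive part of the integrand is only added here so that the flow
      inequality applies.\<close>
    also have "\<dots> \<le> ennreal (LINT x|\<mu> a. ?\<phi> (x, a)) + (\<integral>\<^sup>+t\<in>{a..b}. ennreal (?g t) \<partial>lebesgue)"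
      by simp
    also have "\<dots> \<le> ennreal (LINT x|\<mu> b. ?\<phi> (x, b)) + (\<integral>\<^sup>+t\<in>{a..b}. ennreal (- ?g t) \<partial>lebesgue)"
      by (rule brakke_inequality[OF assms(1-3) C2_c_nonneg_cutoff[OF R]])
    also have "\<dots> \<le> (\<integral>\<^sup>+x. 1 \<partial>\<mu> b) + ennreal (18 / R\<^sup>2) * V"
    proof (rule add_mono[OF order_trans[OF ennreal_integral_le_nn_integral] neg])
      show "(\<integral>\<^sup>+x. ennreal (?\<phi> (x, b)) \<partial>\<mu> b) \<le> (\<integral>\<^sup>+x. 1 \<partial>\<mu> b)"
        by (intro nn_integral_mono) (use cutoff_le_1 in auto)
    qed
    finally show ?thesis .
  qed
  have lim1: "(\<lambda>N. ennreal (cutoff (real (Suc N)) x)) \<longlonglongrightarrow> 1" for x :: "('n, 'm) minkowski"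
    using tendsto_ennrealI[OF cutoff_tendsto_1[of x]] by simp
  have "(\<lambda>N. 18 * (inverse (real (Suc N)))\<^sup>2) \<longlonglongrightarrow> 18 * 0\<^sup>2"
    by (intro tendsto_intros LIMSEQ_inverse_real_of_nat)
  then have "(\<lambda>N. ennreal (18 / (real (Suc N))\<^sup>2)) \<longlonglongrightarrow> ennreal 0"
    by (intro tendsto_ennrealI) (simp add: divide_inverse power_inverse)
  \<comment> \<open>Finiteness of \<open>V\<close> excludes the form 0 times infinity in the limit.
    The total mass of \<open>\<mu> b\<close> may be infinite.\<close>
  moreover have "V \<noteq> \<infinity>" using assms(4) by (simp add: V_def)
  ultimately have "(\<lambda>N. (\<integral>\<^sup>+x. 1 \<partial>\<mu> b) + ennreal (18 / (real (Suc N))\<^sup>2) * V)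
      \<longlonglongrightarrow> (\<integral>\<^sup>+x. 1 \<partial>\<mu> b) + ennreal 0 * V"
    by (intro tendsto_add tendsto_const tendsto_mult_ennreal) auto
  then have lim2: "liminf (\<lambda>N. (\<integral>\<^sup>+x. 1 \<partial>\<mu> b) + ennreal (18 / (real (Suc N))\<^sup>2) * V) = (\<integral>\<^sup>+x. 1 \<partial>\<mu> b)"
    by (intro lim_imp_Liminf) simp_all
  \<comment> \<open>Fatou's lemma passes to the limit on the left, using only pointwise convergence
    of the cutoffs to 1.\<close>
  have "(\<integral>\<^sup>+x. 1 \<partial>\<mu> a) = (\<integral>\<^sup>+x. liminf (\<lambda>N. ennreal (cutoff (real (Suc N)) x)) \<partial>\<mu> a)"
    using lim_imp_Liminf[OF _ lim1] by simp
  also have "\<dots> \<le> liminf (\<lambda>N. \<integral>\<^sup>+x. ennreal (cutoff (real (Suc N)) x) \<partial>\<mu> a)"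
    by (rule nn_integral_liminf) (use borel_measurable_cutoff[OF rad(1)] in measurable)
  also have "\<dots> \<le> liminf (\<lambda>N. (\<integral>\<^sup>+x. 1 \<partial>\<mu> b) + ennreal (18 / (real (Suc N))\<^sup>2) * V)"
    by (intro Liminf_mono always_eventually allI est) simp
  also note lim2
  finally show ?thesis .
qed

end
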